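(* Let $X$ be a reflexive real Banach space such that $X$ and $X^*$ are strictly convex, let $A\subset X$ be nonempty, and let $f:X\to\mathbb{R}$ be Lipschitz continuous with Lipschitz constant $L$ on a neighborhood of $A$. Assume $0\notin\partial f(A)$. Let $\tilde a$ be the unique element of $\partial f(A)$ with $\|\tilde a\|=\min_{a\in\partial f(A)}\|a\|$ and let $\tilde h$ be the unique optimal descent direction of $f$ on $A$, which is characterized by $\langle\tilde a,\tilde h\rangle=-\|\tilde a\|$ and $\|\tilde h\|=1$. Then every $h\in X$ with $$\|h-\tilde h\|<\frac{\|\tilde a\|}{L}$$ is a descent direction of $f$ on $A$.
   Context: $X^*$ is the dual of $X$ (with dual norm) and $\langle\cdot,\cdot\rangle$ the duality pairing; a space is called strictly convex if its norm is. For $f$ Lipschitz near $x$, Clarke's generalized directional derivative is $f^0(x;h)=\limsup_{y\to x,\,t\downarrow 0}\frac{f(y+th)-f(y)}{t}$ and Clarke's generalized gradient is $\partial f(x)=\{a\in X^*\mid\langle a,h\rangle\le f^0(x;h)\ \forall h\in X\}$. For nonempty $A\subset X$, the gradient of $f$ on $A$ is $\partial f(A):=\overline{\operatorname{conv}}^*\bigcup_{y\in A}\partial f(y)$ (the weak$^*$ closure of the convex hull), and the directional derivative of $f$ on $A$ in direction $h\in X$ is $f^0(A;h):=\sup_{y\in A}f^0(y;h)$. An element $h\in X$ is a descent direction of $f$ on $A$ if $f^0(A;h)<0$; $\tilde h\in X$ is an optimal descent direction of $f$ on $A$ if $\|\tilde h\|=1$ and $f^0(A;\tilde h)=\min_{\|h\|\le1}f^0(A;h)<0$.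 (Under the stated hypotheses $\tilde a$ and $\tilde h$ exist and are unique.) A neighborhood of $A$ is a set containing an open set that contains $A$. *)

theory Defs
  imports "HOL-Analysis.Analysis"
begin

text \<open>
  The dual of \<open>'a\<close> is \<open>'a \<Rightarrow>\<^sub>L real\<close> with its operator norm, and the duality pairing of
  \<open>a\<close> and \<open>h\<close> is \<open>blinfun_apply a h\<close>.
\<close>

definition bidual_embedding :: "'a::real_normed_vector \<Rightarrow> ('a \<Rightarrow>\<^sub>L real) \<Rightarrow>\<^sub>L real" where
  "bidual_embedding x = Blinfun (\<lambda>a. blinfun_apply a x)"

text \<open>\<open>Blinfun\<close> is only meaningful on bounded linear maps; evaluation at \<open>x\<close> is one.\<close>

lemma bidual_embedding_apply [simp]:
  "blinfun_apply (bidual_embedding x) a = blinfun_apply a x"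
  unfolding bidual_embedding_def
  by (subst bounded_linear_Blinfun_apply) (simp_all add: blinfun.bounded_linear_left)

definition reflexive_space :: "'a::real_normed_vector itself \<Rightarrow> bool" where
  "reflexive_space _ \<longleftrightarrow> surj (bidual_embedding :: 'a \<Rightarrow> _)"

definition strictly_convex_space :: "'a::real_normed_vector itself \<Rightarrow> bool" where
  "strictly_convex_space _ \<longleftrightarrow>
     (\<forall>(x::'a) y t. norm x = 1 \<and> norm y = 1 \<and> x \<noteq> y \<and> 0 < t \<and> t < 1 \<longrightarrow>
        norm ((1 - t) *\<^sub>R x + t *\<^sub>R y) < 1)"

text \<open>
  The upper limit is taken in \<open>ereal\<close>, so that it is defined for every function; it is finite
  where \<open>f\<close> is locally Lipschitz. The filter \<open>nhds x\<close> allows \<open>y = x\<close>.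
\<close>

definition clarke_dd :: "('a::real_normed_vector \<Rightarrow> real) \<Rightarrow> 'a \<Rightarrow> 'a \<Rightarrow> ereal" where
  "clarke_dd f x h =
     Limsup (nhds x \<times>\<^sub>F at_right 0) (\<lambda>(y, t). ereal ((f (y + t *\<^sub>R h) - f y) / t))"

definition clarke_gradient :: "('a::real_normed_vector \<Rightarrow> real) \<Rightarrow> 'a \<Rightarrow> ('a \<Rightarrow>\<^sub>L real) set" where
  "clarke_gradient f x = {a. \<forall>h. ereal (blinfun_apply a h) \<le> clarke_dd f x h}"

text \<open>
  On \<open>'a \<Rightarrow>\<^sub>L real\<close> the strong operator topology is the topology of pointwise convergence,
  which is the weak-* topology of the dual.
\<close>

definition clarke_gradient_on ::
    "('a::real_normed_vector \<Rightarrow> real) \<Rightarrow> 'a set \<Rightarrow> ('a \<Rightarrow>\<^sub>L real) set" where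
  "clarke_gradient_on f A =
     strong_operator_topology closure_of (convex hull (\<Union>y\<in>A. clarke_gradient f y))"

definition clarke_dd_on :: "('a::real_normed_vector \<Rightarrow> real) \<Rightarrow> 'a set \<Rightarrow> 'a \<Rightarrow> ereal" where
  "clarke_dd_on f A h = (SUP y\<in>A. clarke_dd f y h)"

definition descent_direction ::
    "('a::real_normed_vector \<Rightarrow> real) \<Rightarrow> 'a set \<Rightarrow> 'a \<Rightarrow> bool" where
  "descent_direction f A h \<longleftrightarrow> clarke_dd_on f A h < 0"

definition optimal_descent_direction ::
    "('a::real_normed_vector \<Rightarrow> real) \<Rightarrow> 'a set \<Rightarrow> 'a \<Rightarrow> bool" where
  "optimal_descent_direction f A h \<longleftrightarrow>
     norm h = 1 \<and> is_arg_min (clarke_dd_on f A) (\<lambda>k. norm k \<le> 1) h \<and> clarke_dd_on f A h < 0"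

end

(*
  For an arbitrary nonempty A the function P = f^0(A;.) is real-valued, sublinear and bounded by
  L times the norm, and the gradient of f on A is exactly the set of linear minorants of P. So the
  minimal norm d of the gradient equals minus the minimum of P on the unit ball; both extrema are
  attained by the Mazur--Orlicz form of the Hahn--Banach theorem together with reflexivity. For
  the optimal direction k, sublinearity gives P h <= P k + P (h - k) <= - d + L * norm (h - k),
  which is negative for norm (h - k) < d / L.
*)

theory Submission
  imports Defs
begin

section \<open>Sublinear functionals and the Mazur--Orlicz theorem\<close>

text \<open>Neither extremum comes from a compactness argument; both are produced as linear
  functionals. On the primal side, the bound \<open>- d * norm h \<le> P h\<close> leaves room for a
  linear functional between \<open>- d * norm h\<close> and \<open>P h\<close>, and this is a
  minorant of norm at most \<open>d\<close>. On the dual side, every minorant has norm at least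
  \<open>d\<close>, so a single functional of norm at most 1 on the dual is at least
  \<open>d\<close> on all of them. Reflexivity turns it into evaluation at a point \<open>z\<close>,
  and \<open>- z\<close> is the optimal direction. Uniqueness is a midpoint argument on each side,
  with strict convexity of the dual for the functional and of the space itself for the
  direction.\<close>

definition sublinear :: "('a::real_vector \<Rightarrow> real) \<Rightarrow> bool" where
  "sublinear p \<longleftrightarrow> (\<forall>x y. p (x + y) \<le> p x + p y) \<and> (\<forall>r>0. \<forall>x. p (r *\<^sub>R x) \<le> r * p x) \<and> p 0 = 0"

lemma sublinear_add: "sublinear p \<Longrightarrow> p (x + y) \<le> p x + p y"
  by (simp add: sublinear_def)

lemma sublinear_zero: "sublinear p \<Longrightarrow> p 0 = 0"
  by (simp add: sublinear_def)

text \<open>The reverse inequality is the defining one applied to \<open>r *\<^sub>R x\<close> with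
  the inverse factor. Constructions of sublinear functionals therefore check one direction
  only.\<close>

lemma sublinear_scale:
  assumes "sublinear p" "r \<ge> 0"
  shows "p (r *\<^sub>R x) = r * p x"
proof (cases "r = 0")
  case True
  then show ?thesis by (simp add: sublinear_zero assms)
next
  case False
  then have r: "r > 0" using assms by simp
  have 1: "p (r *\<^sub>R x) \<le> r * p x" using assms r by (simp add: sublinear_def)
  have "p (inverse r *\<^sub>R (r *\<^sub>R x)) \<le> inverse r * p (r *\<^sub>R x)"
    using assms r unfolding sublinear_def by (meson positive_imp_inverse_positive)
  then have "p x \<le> inverse r * p (r *\<^sub>R x)" using r by simp
  then have "r * p x \<le> p (r *\<^sub>R x)" using r by (simp add: field_simps)
  with 1 show ?thesis by simp
qed

lemma sublinear_neg: "sublinear p \<Longrightarrow> - p (- x) \<le> p x"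
  using sublinear_add[of p x "- x"] sublinear_zero[of p] by simp

text \<open>The infimum of \<open>p (b + t *\<^sub>R x) - t * c\<close> over
  \<open>t \<ge> 0\<close> and \<open>x \<in> C\<close> is the largest sublinear functional below
  \<open>p\<close> that satisfies the new constraint. The constraint is put at \<open>- x\<close>
  because a linear minorant then satisfies \<open>c \<le> f x\<close>.\<close>

lemma sublinear_lowering:
  fixes p :: "'a::real_vector \<Rightarrow> real"
  assumes p: "sublinear p" and C: "convex C" "C \<noteq> {}" and c: "\<And>x. x \<in> C \<Longrightarrow> c \<le> p x"
  shows "\<exists>q. sublinear q \<and> q \<le> p \<and> (\<forall>x\<in>C. q (- x) \<le> - c)"
proof -
  define S where "S b = {p (b + t *\<^sub>R x) - t * c | t x. t \<ge> 0 \<and> x \<in> C}" for b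
  define q where "q b = Inf (S b)" for b
  \<comment> \<open>A bound independent of \<open>t\<close> and \<open>x\<close> keeps the infimum
    finite; it rests on \<open>c \<le> p x\<close> for \<open>x\<close> in \<open>C\<close>.\<close>
  have lower: "- p (- b) \<le> s" if s: "s \<in> S b" for s b
  proof -
    obtain t x where tx: "t \<ge> 0" "x \<in> C" "s = p (b + t *\<^sub>R x) - t * c"
      using s unfolding S_def by blast
    have "p (t *\<^sub>R x) \<le> p (- b) + p (b + t *\<^sub>R x)"
      using sublinear_add[OF p, of "- b" "b + t *\<^sub>R x"] by simp
    moreover have "t * c \<le> p (t *\<^sub>R x)"
      using sublinear_scale[OF p tx(1)] c[OF tx(2)] tx(1) by (simp add: mult_left_mono)
    ultimately show ?thesis using tx by simp
  qed
  have bdd: "bdd_below (S b)" for b using lower by (meson bdd_belowI)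
  have ne: "S b \<noteq> {}" for b using C by (auto simp: S_def intro: exI[of _ 0])
  have q_le: "q b \<le> p (b + t *\<^sub>R x) - t * c" if "t \<ge> 0" "x \<in> C" for t x b
    unfolding q_def by (rule cInf_lower[OF _ bdd]) (use that in \<open>auto simp: S_def\<close>)
  have q_near: "\<exists>t x. t \<ge> 0 \<and> x \<in> C \<and> p (b + t *\<^sub>R x) - t * c < v" if v: "q b < v" for b v
    using cInf_lessD[OF ne v[unfolded q_def]] by (auto simp: S_def)
  obtain x0 where x0: "x0 \<in> C" using C by blast
  have qp: "q b \<le> p b" for b using q_le[of 0 x0 b] x0 by simp
  have add: "q (a + b) \<le> q a + q b" for a b
  proof (rule field_le_epsilon)
    fix e :: real assume e: "e > 0"
    obtain s x where s: "s \<ge> 0" "x \<in> C" "p (a + s *\<^sub>R x) - s * c < q a + e / 2"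
      using q_near[of a "q a + e / 2"] e by auto
    obtain t y where t: "t \<ge> 0" "y \<in> C" "p (b + t *\<^sub>R y) - t * c < q b + e / 2"
      using q_near[of b "q b + e / 2"] e by auto
    \<comment> \<open>Convexity merges the two multiples into one multiple of a point of
      \<open>C\<close>. The normalising factor \<open>s + t\<close> may vanish, and then any point
      serves.\<close>
    obtain z where z: "z \<in> C" "s *\<^sub>R x + t *\<^sub>R y = (s + t) *\<^sub>R z"
    proof (cases "s + t = 0")
      case True
      then have "s = 0" "t = 0" using s t by auto
      then show ?thesis using that[of x0] x0 by simp
    next
      case False
      let ?z = "(s / (s + t)) *\<^sub>R x + (t / (s + t)) *\<^sub>R y"
      have "?z \<in> C"
        using C(1) s t False by (intro convexD) (auto simp: add_divide_distrib[symmetric])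
      moreover have "(s + t) *\<^sub>R ?z = s *\<^sub>R x + t *\<^sub>R y"
        using False by (simp add: scaleR_add_right)
      ultimately show ?thesis using that by simp
    qed
    have "q (a + b) \<le> p ((a + b) + (s + t) *\<^sub>R z) - (s + t) * c"
      using q_le[of "s + t" z] s t z by simp
    also have "(a + b) + (s + t) *\<^sub>R z = (a + s *\<^sub>R x) + (b + t *\<^sub>R y)"
      using z(2)[symmetric] by (simp add: algebra_simps)
    also have "p \<dots> \<le> p (a + s *\<^sub>R x) + p (b + t *\<^sub>R y)" by (rule sublinear_add[OF p])
    finally show "q (a + b) \<le> q a + q b + e" using s t by (simp add: algebra_simps)
  qed
  have scale: "q (r *\<^sub>R b) \<le> r * q b" if r: "r > 0" for r b
  proof (rule field_le_epsilon)
    fix e :: real assume e: "e > 0"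
    obtain s x where s: "s \<ge> 0" "x \<in> C" "p (b + s *\<^sub>R x) - s * c < q b + e / r"
      using q_near[of b "q b + e / r"] e r by auto
    have "q (r *\<^sub>R b) \<le> p (r *\<^sub>R b + (r * s) *\<^sub>R x) - (r * s) * c"
      using q_le[of "r * s" x] s r by simp
    also have "r *\<^sub>R b + (r * s) *\<^sub>R x = r *\<^sub>R (b + s *\<^sub>R x)" by (simp add: scaleR_add_right)
    also have "p \<dots> = r * p (b + s *\<^sub>R x)" using sublinear_scale[OF p] r by simp
    also have "r * p (b + s *\<^sub>R x) - r * s * c = r * (p (b + s *\<^sub>R x) - s * c)"
      by (simp add: algebra_simps)
    also have "\<dots> \<le> r * (q b + e / r)" using s r by (intro mult_left_mono) auto
    also have "\<dots> = r * q b + e" using r by (simp add: field_simps)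
    finally show "q (r *\<^sub>R b) \<le> r * q b + e" .
  qed
  have "0 \<le> q 0" unfolding q_def
    using lower[of _ 0] sublinear_zero[OF p] by (intro cInf_greatest[OF ne]) auto
  with qp[of 0] sublinear_zero[OF p] have "q 0 = 0" by simp
  moreover have "q (- x) \<le> - c" if "x \<in> C" for x
    using q_le[of 1 x "- x"] that sublinear_zero[OF p] by simp
  ultimately show ?thesis using add scale qp
    by (intro exI[of _ q]) (auto simp: sublinear_def le_fun_def)
qed

text \<open>Near-minimisers at \<open>x\<close> and at \<open>y\<close> may differ, but in a chain
  the smaller of them is good at both points, which gives subadditivity. The values stay finite
  because \<open>q x \<ge> - q (- x) \<ge> - p (- x)\<close>.\<close>

lemma sublinear_Inf_chain:
  fixes p :: "'a::real_vector \<Rightarrow> real"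
  assumes sub: "\<And>q. q \<in> Q \<Longrightarrow> sublinear q \<and> q \<le> p" and ne: "Q \<noteq> {}"
    and chain: "\<And>q r. q \<in> Q \<Longrightarrow> r \<in> Q \<Longrightarrow> q \<le> r \<or> r \<le> q"
  shows "\<exists>m. sublinear m \<and> (\<forall>q\<in>Q. m \<le> q)"
proof -
  define m where "m x = (INF q\<in>Q. q x)" for x
  have "- p (- x) \<le> q x" if "q \<in> Q" for q x
    using sub[OF that] sublinear_neg[of q x] by (auto simp: le_fun_def intro: order_trans[rotated])
  then have bdd: "bdd_below ((\<lambda>q. q x) ` Q)" for x by (auto intro!: bdd_belowI)
  have m_le: "m x \<le> q x" if "q \<in> Q" for q x
    unfolding m_def using bdd that by (rule cINF_lower)
  have near: "\<exists>q\<in>Q. q x < v" if "m x < v" for x v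
    using that bdd ne unfolding m_def by (subst (asm) cINF_less_iff) auto
  have "m (x + y) \<le> m x + m y" for x y
  proof (rule field_le_epsilon)
    fix e :: real assume e: "e > 0"
    obtain q where q: "q \<in> Q" "q x < m x + e / 2" using near[of x "m x + e / 2"] e by auto
    obtain r where r: "r \<in> Q" "r y < m y + e / 2" using near[of y "m y + e / 2"] e by auto
    obtain s where s: "s \<in> Q" "s \<le> q" "s \<le> r" using chain[OF q(1) r(1)] q(1) r(1) by blast
    have "m (x + y) \<le> s x + s y"
      using m_le[OF s(1), of "x + y"] sub[OF s(1)] sublinear_add[of s x y] by linarith
    moreover have "s x \<le> q x" "s y \<le> r y" using s by (auto simp: le_fun_def)
    ultimately show "m (x + y) \<le> m x + m y + e" using q r by linarith
  qed
  moreover have "m (r *\<^sub>R x) \<le> r * m x" if r: "r > 0" for r x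
  proof (rule field_le_epsilon)
    fix e :: real assume e: "e > 0"
    obtain q where q: "q \<in> Q" "q x < m x + e / r" using near[of x "m x + e / r"] e r by auto
    have "m (r *\<^sub>R x) \<le> r * q x"
      using m_le[OF q(1), of "r *\<^sub>R x"] sub[OF q(1)] sublinear_scale[of q r x] r by simp
    also have "\<dots> \<le> r * (m x + e / r)" using q r by (intro mult_left_mono) auto
    also have "\<dots> = r * m x + e" using r by (simp add: field_simps)
    finally show "m (r *\<^sub>R x) \<le> r * m x + e" .
  qed
  moreover have "m 0 = 0"
  proof -
    have "(\<lambda>q. q 0) ` Q = {0}" using sub ne by (auto simp: sublinear_zero image_iff)
    then show ?thesis unfolding m_def by simp
  qed
  ultimately show ?thesis using m_le
    by (intro exI[of _ m]) (auto simp: sublinear_def le_fun_def)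
qed

text \<open>A minimal sublinear functional is odd, since lowering it at a single point leaves it
  unchanged; hence it is linear.\<close>

theorem sublinear_dominates_linear:
  fixes p :: "'a::real_vector \<Rightarrow> real"
  assumes p: "sublinear p"
  shows "\<exists>f. linear f \<and> f \<le> p"
proof -
  define Q where "Q = {q. sublinear q \<and> q \<le> p}"
  \<comment> \<open>Ordering by \<open>(\<ge>)\<close> makes the maximal element of Zorn's lemma a
    minimal functional.\<close>
  have po: "partial_order_on Q (relation_of (\<ge>) Q)"
    by (rule partial_order_on_relation_ofI[where P = "(\<ge>)"]) auto
  have lower: "\<exists>m\<in>Q. \<forall>q\<in>C. q \<ge> m" if C: "C \<in> Chains (relation_of (\<ge>) Q)" for C
  proof -
    from C have CQ: "C \<subseteq> Q" and chain: "\<And>q r. q \<in> C \<Longrightarrow> r \<in> C \<Longrightarrow> q \<le> r \<or> r \<le> q"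
      by (auto simp: Chains_def relation_of_def)
    show "\<exists>m\<in>Q. \<forall>q\<in>C. q \<ge> m"
    proof (cases "C = {}")
      case True
      then show ?thesis using p by (auto simp: Q_def)
    next
      case False
      obtain m where m: "sublinear m" "\<forall>q\<in>C. m \<le> q"
        using sublinear_Inf_chain[of C p] CQ chain False unfolding Q_def by blast
      moreover have "m \<le> p"
      proof -
        obtain q where "q \<in> C" using False by blast
        with m CQ have "m \<le> q" "q \<le> p" by (auto simp: Q_def)
        then show ?thesis by (rule order_trans)
      qed
      ultimately show ?thesis by (auto simp: Q_def)
    qed
  qed
  obtain m where "m \<in> Q" and "\<forall>q\<in>Q. m \<ge> q \<longrightarrow> q = m"
    using predicate_Zorn[OF po lower] by blast
  then have m: "sublinear m" "m \<le> p"
    and min: "\<And>q. sublinear q \<Longrightarrow> q \<le> m \<Longrightarrow> q = m"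
    by (auto simp: Q_def)
  have odd: "m (- x) = - m x" for x
  proof -
    obtain q where "sublinear q" "q \<le> m" "q (- x) \<le> - m x"
      using sublinear_lowering[OF m(1), of "{x}" "m x"] by auto
    with min have "m (- x) \<le> - m x" by blast
    with sublinear_neg[OF m(1), of x] show ?thesis by simp
  qed
  have add: "m (x + y) = m x + m y" for x y
    using sublinear_add[OF m(1), of x y] sublinear_add[OF m(1), of "- x" "- y"]
      odd[of "x + y"] odd[of x] odd[of y] by simp
  have "m (r *\<^sub>R x) = r * m x" for r x
  proof (cases "r \<ge> 0")
    case True
    then show ?thesis by (rule sublinear_scale[OF m(1)])
  next
    case False
    then have "m ((- r) *\<^sub>R x) = (- r) * m x" by (intro sublinear_scale[OF m(1)]) simp
    then show ?thesis using odd[of "r *\<^sub>R x"] by simp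
  qed
  with add have "linear m" by (intro linearI) auto
  with m show ?thesis by blast
qed

text \<open>A linear minorant of the lowered functional has \<open>f (- x) \<le> - c\<close> on
  \<open>C\<close>, and oddness turns this around. A singleton \<open>C\<close> gives contact with
  \<open>p\<close> at a point; a general convex \<open>C\<close> gives separation.\<close>

theorem Mazur_Orlicz:
  fixes p :: "'a::real_vector \<Rightarrow> real"
  assumes "sublinear p" "convex C" "C \<noteq> {}" "\<And>x. x \<in> C \<Longrightarrow> c \<le> p x"
  shows "\<exists>f. linear f \<and> (\<forall>x. f x \<le> p x) \<and> (\<forall>x\<in>C. c \<le> f x)"
proof -
  obtain q where q: "sublinear q" "q \<le> p" "\<forall>x\<in>C. q (- x) \<le> - c"
    using sublinear_lowering[of p C c] assms by blast
  obtain f where f: "linear f" "f \<le> q" using sublinear_dominates_linear[OF q(1)] by blast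
  have "c \<le> f x" if "x \<in> C" for x
    using le_funD[OF f(2), of "- x"] q(3) that linear_neg[OF f(1), of x] by fastforce
  moreover have "f x \<le> p x" for x
    using f(2) q(2) by (meson le_funD order_trans)
  ultimately show ?thesis using f(1) by blast
qed

section \<open>Continuous functionals and separation in the dual of a reflexive space\<close>

lemma blinfun_of_linear_le_norm:
  fixes f :: "'a::real_normed_vector \<Rightarrow> real"
  assumes "linear f" "\<And>x. f x \<le> d * norm x"
  shows "\<exists>a. blinfun_apply a = f \<and> norm (a :: 'a \<Rightarrow>\<^sub>L real) \<le> max d 0"
proof -
  \<comment> \<open>Oddness makes the one-sided bound two-sided. The maximum with 0 covers a
    negative \<open>d\<close>, which the hypothesis permits in the zero space.\<close>
  have bd: "\<bar>f x\<bar> \<le> max d 0 * norm x" for x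
  proof -
    have "f x \<le> d * norm x" "- f x \<le> d * norm x"
      using assms(2)[of x] assms(2)[of "- x"] linear_neg[OF assms(1), of x] by auto
    moreover have "d * norm x \<le> max d 0 * norm x" by (intro mult_right_mono) auto
    ultimately show ?thesis by linarith
  qed
  have "bounded_linear f"
    using assms(1) bd
    by (intro bounded_linear_intro[of f "max d 0"]) (auto simp: linear_add linear_scale mult.commute)
  then have "blinfun_apply (Blinfun f) = f" by (rule bounded_linear_Blinfun_apply)
  moreover have "norm (Blinfun f) \<le> max d 0"
    by (rule norm_blinfun_bound) (use calculation bd in auto)
  ultimately show ?thesis by blast
qed

lemma blinfun_norm_attaining:
  fixes x :: "'a::real_normed_vector"
  shows "\<exists>a :: 'a \<Rightarrow>\<^sub>L real. norm a \<le> 1 \<and> blinfun_apply a x \<ge> norm x"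
proof -
  have "sublinear (norm :: 'a \<Rightarrow> real)" by (simp add: sublinear_def norm_triangle_ineq)
  then obtain f where f: "linear f" "\<forall>y. f y \<le> norm y" "norm x \<le> f x"
    using Mazur_Orlicz[of norm "{x}" "norm x"] by auto
  obtain a :: "'a \<Rightarrow>\<^sub>L real" where "blinfun_apply a = f" "norm a \<le> max 1 0"
    using blinfun_of_linear_le_norm[OF f(1), of 1] f(2) by auto
  with f show ?thesis by auto
qed

text \<open>Mazur--Orlicz for the dual norm yields an element of the bidual, hence evaluation at
  some \<open>z\<close>. A norming functional of \<open>z\<close> transfers the bound 1 from the
  evaluation to \<open>norm z\<close>.\<close>

lemma reflexive_separation:
  fixes C :: "('a::real_normed_vector \<Rightarrow>\<^sub>L real) set"
  assumes refl: "reflexive_space TYPE('a)" and C: "convex C" "C \<noteq> {}"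
    and c: "\<And>a. a \<in> C \<Longrightarrow> c \<le> norm a"
  shows "\<exists>z. norm z \<le> 1 \<and> (\<forall>a\<in>C. c \<le> blinfun_apply a z)"
proof -
  have "sublinear (norm :: ('a \<Rightarrow>\<^sub>L real) \<Rightarrow> real)" by (simp add: sublinear_def norm_triangle_ineq)
  then obtain f where f: "linear f" "\<forall>y. f y \<le> norm y" "\<forall>x\<in>C. c \<le> f x"
    using Mazur_Orlicz[of norm C c] C c by auto
  obtain F :: "('a \<Rightarrow>\<^sub>L real) \<Rightarrow>\<^sub>L real" where F: "blinfun_apply F = f"
    using blinfun_of_linear_le_norm[OF f(1), of 1] f(2) by auto
  obtain z where z: "F = bidual_embedding z"
    using refl unfolding reflexive_space_def surj_def by blast
  have fz: "f a = blinfun_apply a z" for a using F z by auto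
  obtain a :: "'a \<Rightarrow>\<^sub>L real" where "norm a \<le> 1" "blinfun_apply a z \<ge> norm z"
    using blinfun_norm_attaining[of z] by auto
  with f(2) fz have "norm z \<le> 1" by (metis order_trans)
  with f(3) fz show ?thesis by auto
qed

section \<open>Optimal descent for a sublinear functional\<close>

text \<open>A linear functional below \<open>P x + d * norm y\<close> and nonnegative on the diagonal splits into \<open>a\<close>
  and \<open>- a\<close>, where \<open>a\<close> is the wanted minorant.\<close>

lemma min_norm_minorant:
  fixes P :: "'a::real_normed_vector \<Rightarrow> real"
  assumes P: "sublinear P" and d: "d \<ge> 0" "\<And>h. norm h \<le> 1 \<Longrightarrow> - d \<le> P h"
  shows "\<exists>a :: 'a \<Rightarrow>\<^sub>L real. (\<forall>h. blinfun_apply a h \<le> P h) \<and> norm a \<le> d"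
proof -
  have lower: "- d * norm h \<le> P h" for h
  proof (cases "h = 0")
    case True
    then show ?thesis using sublinear_zero[OF P] by simp
  next
    case False
    have "P (norm h *\<^sub>R sgn h) = norm h * P (sgn h)"
      by (rule sublinear_scale[OF P]) simp
    then have "P h = norm h * P (sgn h)" using False by (simp add: sgn_div_norm)
    moreover have "- d \<le> P (sgn h)" by (rule d(2)) (simp add: norm_sgn)
    ultimately show ?thesis
      using mult_left_mono[of "- d" "P (sgn h)" "norm h"] by (simp add: mult.commute)
  qed
  define p :: "'a \<times> 'a \<Rightarrow> real" where "p = (\<lambda>(x, y). P x + d * norm y)"
  have p: "sublinear p"
  proof -
    have "p (z + w) \<le> p z + p w" for z w
      using sublinear_add[OF P, of "fst z" "fst w"]
        mult_left_mono[OF norm_triangle_ineq[of "snd z" "snd w"] d(1)]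
      by (simp add: p_def case_prod_beta distrib_left)
    moreover have "p (r *\<^sub>R z) \<le> r * p z" if "r > 0" for r z
      using sublinear_scale[OF P, of r "fst z"] that
      by (simp add: p_def case_prod_beta distrib_left)
    moreover have "p 0 = 0" using sublinear_zero[OF P] by (simp add: p_def case_prod_beta)
    ultimately show ?thesis by (simp add: sublinear_def)
  qed
  let ?D = "range (\<lambda>h::'a. (h, h))"
  have "convex ?D"
  proof (rule convexI)
    fix x y :: "'a \<times> 'a" and u v :: real
    assume "x \<in> ?D" "y \<in> ?D"
    then obtain h k where "x = (h, h)" "y = (k, k)" by blast
    then have "u *\<^sub>R x + v *\<^sub>R y = (u *\<^sub>R h + v *\<^sub>R k, u *\<^sub>R h + v *\<^sub>R k)" by simp
    then show "u *\<^sub>R x + v *\<^sub>R y \<in> ?D" by blast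
  qed
  moreover have "0 \<le> p x" if x: "x \<in> ?D" for x
  proof -
    obtain h where "x = (h, h)" using x by blast
    with lower[of h] show ?thesis by (simp add: p_def)
  qed
  ultimately obtain f where f: "linear f" "\<forall>x. f x \<le> p x" "\<forall>x\<in>?D. 0 \<le> f x"
    using Mazur_Orlicz[OF p, of ?D 0] by blast
  define g where "g h = f (h, 0)" for h
  have g: "linear g"
  proof (rule linearI)
    show "g (x + y) = g x + g y" for x y
      using linear_add[OF f(1), of "(x, 0)" "(y, 0)"] by (simp add: g_def)
    show "g (r *\<^sub>R x) = r *\<^sub>R g x" for r x
      using linear_scale[OF f(1), of r "(x, 0)"] by (simp add: g_def)
  qed
  have gP: "g h \<le> P h" for h using f(2)[rule_format, of "(h, 0)"] by (simp add: g_def p_def)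
  have "g h \<le> d * norm h" for h
  proof -
    \<comment> \<open>Nonnegativity at \<open>- h\<close> reads \<open>g h \<le> f (0, - h)\<close>,
      and the second slot is controlled by \<open>d * norm h\<close>.\<close>
    have "0 \<le> f (- h, - h)" using f(3) by blast
    also have "(- h, - h) = - (h, 0) + (0, - h)" by simp
    also have "f \<dots> = - g h + f (0, - h)"
      unfolding g_def using f(1) by (simp only: linear_add linear_neg)
    also have "f (0, - h) \<le> d * norm h"
      using f(2)[rule_format, of "(0, - h)"] sublinear_zero[OF P] by (simp add: p_def)
    finally show ?thesis by simp
  qed
  from blinfun_of_linear_le_norm[OF g this] obtain a :: "'a \<Rightarrow>\<^sub>L real"
    where "blinfun_apply a = g" "norm a \<le> max d 0" by blast
  with gP d(1) show ?thesis by auto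
qed

text \<open>Mazur--Orlicz on the singleton \<open>{k}\<close> with level \<open>P k\<close> forces
  contact at \<open>k\<close>, and the bound by \<open>L\<close> makes the functional
  continuous.\<close>

lemma sublinear_minorant_attains:
  fixes P :: "'a::real_normed_vector \<Rightarrow> real"
  assumes P: "sublinear P" and L: "\<And>h. P h \<le> L * norm h"
  shows "\<exists>a :: 'a \<Rightarrow>\<^sub>L real. (\<forall>h. blinfun_apply a h \<le> P h) \<and> P k \<le> blinfun_apply a k"
proof -
  obtain f where f: "linear f" "\<forall>x. f x \<le> P x" "P k \<le> f k"
    using Mazur_Orlicz[OF P, of "{k}" "P k"] by auto
  have "f x \<le> L * norm x" for x using f(2) L order_trans by blast
  from blinfun_of_linear_le_norm[OF f(1) this] f show ?thesis by auto
qed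

lemma strictly_convex_midpoint:
  fixes x y :: "'a::real_normed_vector"
  assumes "strictly_convex_space TYPE('a)" "norm x = d" "norm y = d" "d > 0" "x \<noteq> y"
  shows "norm ((1 / 2) *\<^sub>R x + (1 / 2) *\<^sub>R y) < d"
proof -
  have "norm ((1 - 1 / 2) *\<^sub>R (x /\<^sub>R d) + (1 / 2) *\<^sub>R (y /\<^sub>R d)) < 1"
    using assms(1)[unfolded strictly_convex_space_def, rule_format, of "x /\<^sub>R d" "y /\<^sub>R d" "1 / 2"] assms(2-)
    by simp
  also have "(1 - 1 / 2) *\<^sub>R (x /\<^sub>R d) + (1 / 2) *\<^sub>R (y /\<^sub>R d)
      = inverse d *\<^sub>R ((1 / 2) *\<^sub>R x + (1 / 2) *\<^sub>R y)"
    by (simp add: scaleR_add_right mult.commute)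
  finally have "inverse d * norm ((1 / 2) *\<^sub>R x + (1 / 2) *\<^sub>R y) < 1"
    using assms(4) by (simp only: norm_scaleR) simp
  then show ?thesis using assms(4) by (simp add: field_simps)
qed

lemma optimal_descent_sublinear:
  fixes P :: "'a::real_normed_vector \<Rightarrow> real"
  assumes refl: "reflexive_space TYPE('a)" and P: "sublinear P"
    and L: "L \<ge> 0" "\<And>h. \<bar>P h\<bar> \<le> L * norm h"
    and G: "G = {a :: 'a \<Rightarrow>\<^sub>L real. \<forall>h. blinfun_apply a h \<le> P h}" and zero: "0 \<notin> G"
  obtains d a k where "d > 0" "a \<in> G" "norm a = d" "\<And>b. b \<in> G \<Longrightarrow> d \<le> norm b"
    "norm k = 1" "P k = - d" "\<And>h. norm h \<le> 1 \<Longrightarrow> - d \<le> P h"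
proof -
  define d where "d = - (INF h\<in>cball 0 1. P h)"
  have "- L \<le> P h" if "norm h \<le> 1" for h
    using L(2)[of h] mult_left_mono[OF that L(1)] by linarith
  then have bdd: "bdd_below (P ` cball 0 1)" by (auto intro!: bdd_belowI)
  have lower: "- d \<le> P h" if "norm h \<le> 1" for h
    unfolding d_def using cINF_lower[OF bdd, of h] that by simp
  have "d \<ge> 0" using lower[of 0] sublinear_zero[OF P] by simp
  obtain a where "\<forall>h. blinfun_apply a h \<le> P h" and "norm a \<le> d"
    using min_norm_minorant[OF P \<open>d \<ge> 0\<close> lower] by blast
  then have a: "a \<in> G" "norm a \<le> d" unfolding G by blast+
  \<comment> \<open>Weak duality: a minorant \<open>b\<close> forces \<open>P\<close> to be at least
    \<open>- norm b\<close> on the unit ball.\<close>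
  have min: "d \<le> norm b" if b: "b \<in> G" for b
  proof -
    have "- norm b \<le> P h" if "norm h \<le> 1" for h
    proof -
      have "\<bar>blinfun_apply b h\<bar> \<le> norm b * norm h" using norm_blinfun[of b h] by simp
      also have "\<dots> \<le> norm b" using mult_left_mono[OF that, of "norm b"] by simp
      finally have "- norm b \<le> blinfun_apply b h" by linarith
      also have "\<dots> \<le> P h" using b unfolding G by blast
      finally show ?thesis .
    qed
    then have "- norm b \<le> (INF h\<in>cball 0 1. P h)" by (intro cINF_greatest) auto
    then show ?thesis by (simp add: d_def)
  qed
  have ne: "G \<noteq> {}" using a(1) by blast
  have "a \<noteq> 0" using a zero by auto
  then have "0 < norm a" by simp
  with a have "d > 0" by linarith
  have convex: "convex G"
  proof (rule convexI)
    fix b c :: "'a \<Rightarrow>\<^sub>L real" and u v :: real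
    assume *: "b \<in> G" "c \<in> G" "u \<ge> 0" "v \<ge> 0" "u + v = 1"
    then have "blinfun_apply b h \<le> P h" "blinfun_apply c h \<le> P h" for h
      unfolding G by blast+
    then have "u * blinfun_apply b h + v * blinfun_apply c h \<le> P h" for h
      using *(3-5) by (rule convex_bound_le)
    then show "u *\<^sub>R b + v *\<^sub>R c \<in> G"
      unfolding G by (simp add: blinfun.add_left blinfun.scaleR_left)
  qed
  obtain z where z: "norm z \<le> 1" "\<forall>b\<in>G. d \<le> blinfun_apply b z"
    using reflexive_separation[OF refl convex ne min] by blast
  have upper: "P h \<le> L * norm h" for h using L(2)[of h] by linarith
  \<comment> \<open>\<open>P (- z)\<close> is the value of some minorant at \<open>- z\<close>, so
    the uniform bound on \<open>G\<close> passes to \<open>P\<close>.\<close>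
  obtain b where b: "b \<in> G" "P (- z) \<le> blinfun_apply b (- z)"
    using sublinear_minorant_attains[OF P upper, of "- z"] unfolding G by blast
  have "d \<le> blinfun_apply b z" using z(2) b(1) by blast
  with b(2) have "P (- z) \<le> - d" by (simp add: blinfun.minus_right)
  moreover have "- d \<le> P (- z)" using z(1) by (intro lower) simp
  ultimately have "P (- z) = - d" by simp
  \<comment> \<open>The chain \<open>d \<le> d * norm z\<close> with \<open>d > 0\<close> puts
    \<open>z\<close> on the unit sphere.\<close>
  have "d \<le> blinfun_apply a z" using z(2) a(1) by blast
  also have "\<dots> \<le> norm a * norm z" using norm_blinfun[of a z] by simp
  also have "\<dots> \<le> d * norm z" by (rule mult_right_mono[OF a(2)]) simp
  finally have "norm (- z) = 1" using z(1) \<open>d > 0\<close> by simp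
  have "norm a = d" using a(2) min[OF a(1)] by (rule antisym)
  show thesis
    by (rule that[of d a "- z"]) fact+
qed

section \<open>Clarke's directional derivative and gradient\<close>

text \<open>One radius serves both the base point and the step length, and the quotient is cleared
  so that increments of \<open>f\<close> can be added.\<close>

lemma clarke_dd_lessD:
  fixes f :: "'a::real_normed_vector \<Rightarrow> real"
  assumes "clarke_dd f x h < ereal c"
  shows "\<exists>\<delta>>0. \<forall>z t. dist z x < \<delta> \<longrightarrow> 0 < t \<longrightarrow> t < \<delta> \<longrightarrow> f (z + t *\<^sub>R h) - f z < c * t"
proof -
  obtain Q R where Q: "eventually Q (nhds x)" and R: "eventually R (at_right 0)"
    and QR: "\<And>z t. Q z \<Longrightarrow> R t \<Longrightarrow> (f (z + t *\<^sub>R h) - f z) / t < c"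
    using Limsup_lessD[OF assms[unfolded clarke_dd_def]] unfolding eventually_prod_filter by auto
  obtain \<alpha> where \<alpha>: "\<alpha> > 0" "\<And>z. dist z x < \<alpha> \<Longrightarrow> Q z"
    using Q by (auto simp: eventually_nhds_metric)
  obtain \<beta> where \<beta>: "\<beta> > 0" "\<And>t. 0 < t \<Longrightarrow> t < \<beta> \<Longrightarrow> R t"
    using R by (auto simp: eventually_at_right_field)
  have "f (z + t *\<^sub>R h) - f z < c * t" if "dist z x < min \<alpha> \<beta>" "0 < t" "t < min \<alpha> \<beta>" for z t
    using QR[OF \<alpha>(2) \<beta>(2), of z t] that by (simp add: field_simps)
  then show ?thesis using \<alpha>(1) \<beta>(1) by (intro exI[of _ "min \<alpha> \<beta>"]) auto
qed

lemma clarke_dd_leI: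
  fixes f :: "'a::real_normed_vector \<Rightarrow> real"
  assumes "\<delta> > 0"
    and "\<And>z t. dist z x < \<delta> \<Longrightarrow> 0 < t \<Longrightarrow> t < \<delta> \<Longrightarrow> f (z + t *\<^sub>R h) - f z \<le> c * t"
  shows "clarke_dd f x h \<le> ereal c"
  unfolding clarke_dd_def
proof (rule Limsup_bounded)
  have "\<forall>\<^sub>F z in nhds x. dist z x < \<delta>" using assms(1) by (auto simp: eventually_nhds_metric)
  moreover have "\<forall>\<^sub>F t in at_right 0. 0 < t \<and> t < \<delta>"
    using assms(1) by (auto simp: eventually_at_right_field)
  ultimately show "\<forall>\<^sub>F w in nhds x \<times>\<^sub>F at_right 0.
      (case w of (z, t) \<Rightarrow> ereal ((f (z + t *\<^sub>R h) - f z) / t)) \<le> ereal c"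
    unfolding eventually_prod_filter using assms(2)
    by (intro exI[of _ "\<lambda>z. dist z x < \<delta>"] exI[of _ "\<lambda>t. 0 < t \<and> t < \<delta>"])
      (auto simp: field_simps)
qed

text \<open>The shift adds at most \<open>t * norm h\<close>, so the total stays below
  \<open>r / (1 + norm h)\<close> times \<open>1 + norm h\<close>; the summand 1 accounts for the
  base point.\<close>

lemma dist_shift_less:
  fixes x z h :: "'a::real_normed_vector"
  assumes "dist z x < r / (1 + norm h)" "0 < t" "t < r / (1 + norm h)"
  shows "dist (z + t *\<^sub>R h) x < r"
proof -
  have pos: "1 + norm h > 0" by (smt (verit) norm_ge_zero)
  have "dist (z + t *\<^sub>R h) x \<le> dist z x + t * norm h"
    using norm_triangle_ineq[of "z - x" "t *\<^sub>R h"] assms by (simp add: dist_norm algebra_simps)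
  also have "\<dots> < r / (1 + norm h) + r / (1 + norm h) * norm h"
    using assms by (intro add_less_le_mono mult_right_mono) auto
  also have "\<dots> = r / (1 + norm h) * (1 + norm h)" by (simp only: distrib_left mult_1_right)
  also have "\<dots> = r" using pos by simp
  finally show ?thesis .
qed

lemma clarke_dd_bounds:
  fixes f :: "'a::real_normed_vector \<Rightarrow> real"
  assumes r: "r > 0" and lip: "L-lipschitz_on (ball x r) f"
  shows "clarke_dd f x h \<le> ereal (L * norm h)" "ereal (- (L * norm h)) \<le> clarke_dd f x h"
proof -
  have pos: "1 + norm h > 0" by (smt (verit) norm_ge_zero)
  define \<delta> where "\<delta> = r / (1 + norm h)"
  have \<delta>: "\<delta> > 0" "\<delta> \<le> r"
    unfolding \<delta>_def using r pos by (auto simp: divide_le_eq algebra_simps)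
  have bound: "\<bar>f (z + t *\<^sub>R h) - f z\<bar> \<le> L * norm h * t"
    if "dist z x < \<delta>" "0 < t" "t < \<delta>" for z t
  proof -
    have "z \<in> ball x r" "z + t *\<^sub>R h \<in> ball x r"
      using that \<delta> dist_shift_less[of z x r h t]
      by (auto simp: \<delta>_def dist_commute)
    from lipschitz_onD[OF lip this(2,1)] that show ?thesis by (simp add: dist_norm mult_ac)
  qed
  show "clarke_dd f x h \<le> ereal (L * norm h)"
    by (rule clarke_dd_leI[OF \<delta>(1)]) (use bound in force)
  show "ereal (- (L * norm h)) \<le> clarke_dd f x h"
  proof (rule ccontr)
    assume "\<not> ?thesis"
    then obtain \<epsilon> where \<epsilon>: "\<epsilon> > 0"
      "\<And>z t. dist z x < \<epsilon> \<Longrightarrow> 0 < t \<Longrightarrow> t < \<epsilon> \<Longrightarrow> f (z + t *\<^sub>R h) - f z < - (L * norm h) * t"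
      using clarke_dd_lessD[of f x h "- (L * norm h)"] by (auto simp: not_le)
    \<comment> \<open>A single step from \<open>x\<close> itself, shorter than both radii,
      contradicts the Lipschitz bound.\<close>
    define t where "t = min \<delta> \<epsilon> / 2"
    have "0 < t" "t < \<delta>" "t < \<epsilon>" using \<delta> \<epsilon>(1) by (auto simp: t_def)
    with \<epsilon>(2)[of x t] bound[of x t] \<delta> \<epsilon>(1) show False by simp
  qed
qed

text \<open>For subadditivity the increment along \<open>h + k\<close> is split at
  \<open>z + t *\<^sub>R h\<close>. This intermediate point is again an admissible base point
  because the upper limit lets base points move.\<close>

lemma clarke_dd_sublinear:
  fixes f :: "'a::real_normed_vector \<Rightarrow> real"
  assumes r: "r > 0" and lip: "L-lipschitz_on (ball x r) f"
  shows "\<exists>p. sublinear p \<and> (\<forall>h. clarke_dd f x h = ereal (p h)) \<and> (\<forall>h. \<bar>p h\<bar> \<le> L * norm h)"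
proof -
  define p where "p h = real_of_ereal (clarke_dd f x h)" for h
  have p: "clarke_dd f x h = ereal (p h)" for h
    using clarke_dd_bounds[OF assms, of h] unfolding p_def
    by (cases "clarke_dd f x h") auto
  have bd: "\<bar>p h\<bar> \<le> L * norm h" for h
    using clarke_dd_bounds[OF assms, of h] unfolding p by auto
  have near: "\<exists>\<delta>>0. \<forall>z t. dist z x < \<delta> \<longrightarrow> 0 < t \<longrightarrow> t < \<delta> \<longrightarrow> f (z + t *\<^sub>R h) - f z < c * t"
    if "p h < c" for h c
    using clarke_dd_lessD[of f x h c] that p by simp
  have add: "p (h + k) \<le> p h + p k" for h k
  proof (rule field_le_epsilon)
    fix e :: real assume e: "e > 0"
    obtain \<alpha> where \<alpha>: "\<alpha> > 0"
      "\<And>z t. dist z x < \<alpha> \<Longrightarrow> 0 < t \<Longrightarrow> t < \<alpha> \<Longrightarrow> f (z + t *\<^sub>R h) - f z < (p h + e / 2) * t"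
      using near[of h "p h + e / 2"] e by auto
    obtain \<beta> where \<beta>: "\<beta> > 0"
      "\<And>z t. dist z x < \<beta> \<Longrightarrow> 0 < t \<Longrightarrow> t < \<beta> \<Longrightarrow> f (z + t *\<^sub>R k) - f z < (p k + e / 2) * t"
      using near[of k "p k + e / 2"] e by auto
    have pos: "1 + norm h > 0" by (smt (verit) norm_ge_zero)
    \<comment> \<open>The second term keeps the shifted base point within \<open>\<beta>\<close> of
      \<open>x\<close>.\<close>
    define \<delta> where "\<delta> = min \<alpha> (\<beta> / (1 + norm h))"
    have \<delta>: "\<delta> > 0" using \<alpha> \<beta> pos by (simp add: \<delta>_def)
    have le: "\<beta> / (1 + norm h) \<le> \<beta>" using \<beta>(1) pos by (simp add: divide_le_eq algebra_simps)
    have "clarke_dd f x (h + k) \<le> ereal (p h + p k + e)"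
    proof (rule clarke_dd_leI[OF \<delta>])
      fix z t assume zt: "dist z x < \<delta>" "0 < t" "t < \<delta>"
      have "f (z + t *\<^sub>R h) - f z < (p h + e / 2) * t"
        using \<alpha>(2) zt by (simp add: \<delta>_def)
      moreover have "f ((z + t *\<^sub>R h) + t *\<^sub>R k) - f (z + t *\<^sub>R h) < (p k + e / 2) * t"
        using zt le dist_shift_less[of z x \<beta> h t] by (intro \<beta>(2)) (auto simp: \<delta>_def)
      ultimately show "f (z + t *\<^sub>R (h + k)) - f z \<le> (p h + p k + e) * t"
        by (simp add: algebra_simps)
    qed
    then show "p (h + k) \<le> p h + p k + e" by (simp add: p)
  qed
  have scale: "p (s *\<^sub>R h) \<le> s * p h" if s: "s > 0" for s h
  proof (rule field_le_epsilon)
    fix e :: real assume e: "e > 0"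
    obtain \<alpha> where \<alpha>: "\<alpha> > 0"
      "\<And>z t. dist z x < \<alpha> \<Longrightarrow> 0 < t \<Longrightarrow> t < \<alpha> \<Longrightarrow> f (z + t *\<^sub>R h) - f z < (p h + e / s) * t"
      using near[of h "p h + e / s"] e s by auto
    have "clarke_dd f x (s *\<^sub>R h) \<le> ereal (s * p h + e)"
    \<comment> \<open>A step \<open>t\<close> along \<open>s *\<^sub>R h\<close> is a step
      \<open>t * s\<close> along \<open>h\<close>, so \<open>t < \<alpha> / s\<close> is
      required.\<close>
    proof (rule clarke_dd_leI[of "min \<alpha> (\<alpha> / s)"])
      show "min \<alpha> (\<alpha> / s) > 0" using \<alpha>(1) s by simp
      fix z t assume zt: "dist z x < min \<alpha> (\<alpha> / s)" "0 < t" "t < min \<alpha> (\<alpha> / s)"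
      have "f (z + (t * s) *\<^sub>R h) - f z < (p h + e / s) * (t * s)"
        using zt s by (intro \<alpha>(2)) (auto simp: field_simps)
      also have "(p h + e / s) * (t * s) = (s * p h + e) * t" using s by (simp add: field_simps)
      finally show "f (z + t *\<^sub>R s *\<^sub>R h) - f z \<le> (s * p h + e) * t" by simp
    qed
    then show "p (s *\<^sub>R h) \<le> s * p h + e" by (simp add: p)
  qed
  have "p 0 = 0" using bd[of 0] by simp
  with add scale have "sublinear p" by (simp add: sublinear_def)
  with p bd show ?thesis by blast
qed

section \<open>Directional derivative and gradient on a set\<close>

lemma clarke_dd_on_sublinear:
  fixes f :: "'a::real_normed_vector \<Rightarrow> real"
  assumes ne: "A \<noteq> {}" and lip: "\<And>x. x \<in> A \<Longrightarrow> \<exists>r>0. L-lipschitz_on (ball x r) f"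
  shows "\<exists>P. sublinear P \<and> (\<forall>h. clarke_dd_on f A h = ereal (P h)) \<and> (\<forall>h. \<bar>P h\<bar> \<le> L * norm h)"
proof -
  have "\<forall>x\<in>A. \<exists>p. sublinear p \<and> (\<forall>h. clarke_dd f x h = ereal (p h)) \<and> (\<forall>h. \<bar>p h\<bar> \<le> L * norm h)"
  proof
    fix x assume "x \<in> A"
    then obtain r where "r > 0" "L-lipschitz_on (ball x r) f" using lip by blast
    then show "\<exists>p. sublinear p \<and> (\<forall>h. clarke_dd f x h = ereal (p h)) \<and> (\<forall>h. \<bar>p h\<bar> \<le> L * norm h)"
      by (rule clarke_dd_sublinear)
  qed
  from bchoice[OF this] obtain p where p: "\<And>x. x \<in> A \<Longrightarrow> sublinear (p x)"
    "\<And>x h. x \<in> A \<Longrightarrow> clarke_dd f x h = ereal (p x h)" "\<And>x h. x \<in> A \<Longrightarrow> \<bar>p x h\<bar> \<le> L * norm h"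
    by blast
  obtain y where y: "y \<in> A" using ne by blast
  define P where "P h = real_of_ereal (clarke_dd_on f A h)" for h
  \<comment> \<open>The constant \<open>L\<close> is common to all points although the radii are
    not, so the supremum is finite. Its upper bounds then carry sublinearity over from each
    \<open>p x\<close>.\<close>
  have le_iff: "clarke_dd_on f A h \<le> ereal c \<longleftrightarrow> (\<forall>x\<in>A. p x h \<le> c)" for h c
    unfolding clarke_dd_on_def SUP_le_iff using p(2) by auto
  have upper: "clarke_dd_on f A h \<le> ereal (L * norm h)" for h
    unfolding le_iff using p(3) by (meson abs_le_D1)
  have ge: "ereal (p x h) \<le> clarke_dd_on f A h" if "x \<in> A" for x h
    unfolding clarke_dd_on_def using that p(2) by (metis SUP_upper)
  have P: "clarke_dd_on f A h = ereal (P h)" for h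
    using upper[of h] ge[OF y, of h] unfolding P_def by (cases "clarke_dd_on f A h") auto
  have P_le: "P h \<le> c \<longleftrightarrow> (\<forall>x\<in>A. p x h \<le> c)" for h c using le_iff P by simp
  have bd: "\<bar>P h\<bar> \<le> L * norm h" for h
    using upper[of h] ge[OF y, of h] p(3)[OF y, of h] P[of h] by auto
  have px: "p x h \<le> P h" if "x \<in> A" for x h using P_le that by blast
  have "P (h + k) \<le> P h + P k" for h k
    unfolding P_le using sublinear_add[OF p(1)] px by (meson add_mono order_trans)
  moreover have "P (s *\<^sub>R h) \<le> s * P h" if "s > 0" for s h
    unfolding P_le using sublinear_scale[OF p(1)] px that by simp
  moreover have "P 0 = 0" using bd[of 0] by simp
  ultimately have "sublinear P" by (simp add: sublinear_def)
  with P bd show ?thesis by blast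
qed

text \<open>By reflexivity the weak-* closure of the convex hull is already its norm closure, so a norm
  separation in the dual suffices.\<close>

lemma clarke_gradient_on_eq:
  fixes f :: "'a::real_normed_vector \<Rightarrow> real"
  assumes refl: "reflexive_space TYPE('a)" and ne: "A \<noteq> {}"
    and lip: "\<And>x. x \<in> A \<Longrightarrow> \<exists>r>0. L-lipschitz_on (ball x r) f"
    and P: "\<And>h. clarke_dd_on f A h = ereal (P h)"
  shows "clarke_gradient_on f A = {a. \<forall>h. blinfun_apply a h \<le> P h}"
proof
  let ?G = "{a :: 'a \<Rightarrow>\<^sub>L real. \<forall>h. blinfun_apply a h \<le> P h}"
  define C where "C = convex hull (\<Union>y\<in>A. clarke_gradient f y)"
  have dd_le: "clarke_dd f y h \<le> ereal (P h)" if "y \<in> A" for y h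
    using that unfolding P[symmetric] clarke_dd_on_def by (rule SUP_upper)
  have "(\<Union>y\<in>A. clarke_gradient f y) \<subseteq> ?G"
  proof safe
    fix y a h assume "y \<in> A" "a \<in> clarke_gradient f y"
    then have "ereal (blinfun_apply a h) \<le> ereal (P h)"
      using dd_le order_trans unfolding clarke_gradient_def by blast
    then show "blinfun_apply a h \<le> P h" by simp
  qed
  moreover have "convex ?G"
    by (intro convexI) (auto simp: blinfun.add_left blinfun.scaleR_left intro: convex_bound_le)
  ultimately have CG: "C \<subseteq> ?G" unfolding C_def by (rule hull_minimal)
  have "closedin strong_operator_topology ?G"
  proof -
    have "closedin strong_operator_topology {a :: 'a \<Rightarrow>\<^sub>L real. blinfun_apply a h \<le> P h}" for h
      using closedin_continuous_map_preimage[OF strong_operator_topology_continuous_evaluation,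
          of "{..P h}" h]
      by (simp add: strong_operator_topology_topspace)
    then have "closedin strong_operator_topology (\<Inter>h. {a :: 'a \<Rightarrow>\<^sub>L real. blinfun_apply a h \<le> P h})"
      by (intro closedin_Inter) auto
    also have "(\<Inter>h. {a :: 'a \<Rightarrow>\<^sub>L real. blinfun_apply a h \<le> P h}) = ?G" by auto
    finally show ?thesis .
  qed
  with CG show "clarke_gradient_on f A \<subseteq> ?G"
    unfolding clarke_gradient_on_def C_def by (rule closure_of_minimal)
  \<comment> \<open>The supremum over \<open>A\<close> may not be reached, so only levels strictly
    below \<open>P h\<close> are matched by elements of \<open>C\<close>.\<close>
  have attains: "\<exists>a\<in>C. c \<le> blinfun_apply a h" if c: "c < P h" for c h
  proof -
    have "ereal c < clarke_dd_on f A h" using c P by simp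
    then obtain y where y: "y \<in> A" "ereal c < clarke_dd f y h"
      unfolding clarke_dd_on_def less_SUP_iff by blast
    obtain r where r: "r > 0" "L-lipschitz_on (ball y r) f" using lip y(1) by blast
    obtain p where p: "sublinear p" "\<forall>h. clarke_dd f y h = ereal (p h)" "\<forall>h. \<bar>p h\<bar> \<le> L * norm h"
      using clarke_dd_sublinear[OF r] by blast
    obtain a :: "'a \<Rightarrow>\<^sub>L real" where a: "\<forall>h. blinfun_apply a h \<le> p h" "p h \<le> blinfun_apply a h"
      using sublinear_minorant_attains[OF p(1), of L h] p(3) by (meson abs_le_D1)
    have "a \<in> C" unfolding C_def
      using y a(1) p(2) by (intro hull_inc UN_I[of y]) (auto simp: clarke_gradient_def)
    moreover have "c \<le> blinfun_apply a h" using y(2) p(2) a(2) by simp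
    ultimately show ?thesis by blast
  qed
  have "C \<noteq> {}" using attains[of "P 0 - 1" 0] by auto
  have "?G \<subseteq> closure C"
  proof
    fix a assume a: "a \<in> ?G"
    show "a \<in> closure C"
    proof (rule ccontr)
      assume "a \<notin> closure C"
      then obtain e where e: "e > 0" "\<And>b. b \<in> C \<Longrightarrow> e \<le> dist b a"
        by (force simp: closure_approachable not_less)
      have "convex ((\<lambda>b. b - a) ` C)"
        using convex_translation_subtract[of C a] by (simp add: C_def)
      then obtain z where z: "\<forall>b\<in>(\<lambda>b. b - a) ` C. e \<le> blinfun_apply b z"
        \<comment> \<open>Translating by \<open>a\<close> turns the distance from \<open>a\<close>
          to \<open>C\<close> into a lower bound on norms.\<close>
        using reflexive_separation[OF refl, of "(\<lambda>b. b - a) ` C" e] \<open>C \<noteq> {}\<close> e(2)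
        by (force simp: dist_norm)
      have "blinfun_apply a (- z) \<le> P (- z)" using a by blast
      \<comment> \<open>Separation gives a gap of at least \<open>e\<close> between \<open>b\<close>
        and \<open>a\<close> at \<open>z\<close>, whereas near-attainment at \<open>- z\<close>
        allows at most \<open>e / 2\<close>.\<close>
      then obtain b where "b \<in> C" "P (- z) - e / 2 \<le> blinfun_apply b (- z)"
        using attains[of "P (- z) - e / 2" "- z"] e(1) by auto
      with z \<open>blinfun_apply a (- z) \<le> P (- z)\<close> e(1) show False
        by (auto simp: blinfun.minus_right blinfun.diff_left)
    qed
  qed
  \<comment> \<open>The norm topology is finer, so norm limits are also weak-* limits.\<close>
  also have "closure C \<subseteq> clarke_gradient_on f A"
    using continuous_map_image_closure_subset[OF strong_operator_topology_weaker_than_euclidean, of C]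
    by (simp add: clarke_gradient_on_def C_def euclidean_closure_of)
  finally show "?G \<subseteq> clarke_gradient_on f A" .
qed

section \<open>Uniqueness by strict convexity, and stability of descent\<close>

theorem corollary3p15:
  fixes f :: "'a::banach \<Rightarrow> real" and A N :: "'a set" and L :: real
  assumes "reflexive_space TYPE('a)"
    and "strictly_convex_space TYPE('a)"
    and "strictly_convex_space TYPE('a \<Rightarrow>\<^sub>L real)"
    and "A \<noteq> {}"
    and "\<exists>U. open U \<and> A \<subseteq> U \<and> U \<subseteq> N"
    and "L-lipschitz_on N f"
    and "0 \<notin> clarke_gradient_on f A"
  shows "(\<exists>!a. is_arg_min norm (\<lambda>b. b \<in> clarke_gradient_on f A) a) \<and>
    (\<exists>!h. optimal_descent_direction f A h) \<and>
    (\<forall>a. is_arg_min norm (\<lambda>b. b \<in> clarke_gradient_on f A) a \<longrightarrow>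
      (\<forall>k. optimal_descent_direction f A k \<longleftrightarrow>
         blinfun_apply a k = - norm a \<and> norm k = 1) \<and>
      (\<forall>k. optimal_descent_direction f A k \<longrightarrow>
         (\<forall>h. norm (h - k) < norm a / L \<longrightarrow> descent_direction f A h)))"
proof -
  define G where "G = clarke_gradient_on f A"
  have L0: "L \<ge> 0" using assms(6) by (rule lipschitz_on_nonneg)
  have lip: "\<exists>r>0. L-lipschitz_on (ball x r) f" if x: "x \<in> A" for x
  proof -
    obtain U where "open U" "x \<in> U" "U \<subseteq> N" using assms(5) x by blast
    then obtain r where "r > 0" "ball x r \<subseteq> N" by (meson open_contains_ball order_trans)
    then show ?thesis using assms(6) lipschitz_on_subset by blast
  qed
  obtain P where P: "sublinear P" "\<And>h. clarke_dd_on f A h = ereal (P h)" "\<And>h. \<bar>P h\<bar> \<le> L * norm h"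
    using clarke_dd_on_sublinear[OF assms(4) lip] by blast
  have G: "G = {a. \<forall>h. blinfun_apply a h \<le> P h}"
    unfolding G_def by (rule clarke_gradient_on_eq[OF assms(1,4) lip P(2)])
  obtain d a k where d: "d > 0" and a: "a \<in> G" "norm a = d" and min: "\<And>b. b \<in> G \<Longrightarrow> d \<le> norm b"
    and k: "norm k = 1" "P k = - d" and lower: "\<And>h. norm h \<le> 1 \<Longrightarrow> - d \<le> P h"
    using optimal_descent_sublinear[OF assms(1) P(1) L0 P(3) G assms(7)[folded G_def]] by metis
  have dual_bound: "- d * norm h \<le> blinfun_apply a h" for h
    using norm_blinfun[of a h] a(2) by simp
  have arg_min: "is_arg_min norm (\<lambda>b. b \<in> G) b \<longleftrightarrow> b = a" for b
  proof
    assume b: "is_arg_min norm (\<lambda>b. b \<in> G) b"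
    then have bG: "b \<in> G" "norm b = d"
      using a min unfolding is_arg_min_def by (auto simp: not_less intro: antisym)
    show "b = a"
    proof (rule ccontr)
      assume "b \<noteq> a"
      \<comment> \<open>The midpoint of two distinct minimisers stays in the convex set
        \<open>G\<close> but has norm below \<open>d\<close>.\<close>
      have "norm ((1 / 2) *\<^sub>R b + (1 / 2) *\<^sub>R a) < d"
        using strictly_convex_midpoint[OF assms(3) bG(2) a(2) d \<open>b \<noteq> a\<close>] .
      moreover have "blinfun_apply ((1 / 2) *\<^sub>R b + (1 / 2) *\<^sub>R a) h \<le> P h" for h
      proof -
        have "blinfun_apply b h \<le> P h" "blinfun_apply a h \<le> P h" using bG(1) a(1) G by auto
        then show ?thesis by (simp add: blinfun.add_left blinfun.scaleR_left)
      qed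
      then have "(1 / 2) *\<^sub>R b + (1 / 2) *\<^sub>R a \<in> G" unfolding G by blast
      ultimately show False using min by fastforce
    qed
  next
    assume "b = a"
    then show "is_arg_min norm (\<lambda>b. b \<in> G) b"
      using a min by (auto simp: is_arg_min_def not_less)
  qed
  have opt: "optimal_descent_direction f A h \<longleftrightarrow> norm h = 1 \<and> P h = - d" for h
  proof
    assume "optimal_descent_direction f A h"
    then have h: "norm h = 1" "\<not> P k < P h"
      using k(1) unfolding optimal_descent_direction_def is_arg_min_def P(2) by auto
    with lower[of h] k(2) show "norm h = 1 \<and> P h = - d" by simp
  next
    assume "norm h = 1 \<and> P h = - d"
    then show "optimal_descent_direction f A h"
      using lower d unfolding optimal_descent_direction_def is_arg_min_def P(2)
      by (auto simp: not_less)
  qed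
  have unique: "h = k" if h: "norm h = 1" "blinfun_apply a h = - d" for h
  proof (rule ccontr)
    assume "h \<noteq> k"
    have "blinfun_apply a k \<le> P k" using a(1) G by blast
    with dual_bound[of k] k have ak: "blinfun_apply a k = - d" by simp
    \<comment> \<open>At the midpoint \<open>a\<close> still takes the value \<open>- d\<close>,
      which a vector of norm below 1 cannot achieve.\<close>
    have "norm ((1 / 2) *\<^sub>R h + (1 / 2) *\<^sub>R k) < 1"
      using strictly_convex_midpoint[OF assms(2) h(1) k(1) _ \<open>h \<noteq> k\<close>] by simp
    then have "d * norm ((1 / 2) *\<^sub>R h + (1 / 2) *\<^sub>R k) < d" using d by simp
    moreover have "blinfun_apply a ((1 / 2) *\<^sub>R h + (1 / 2) *\<^sub>R k) = - d"
      by (simp add: blinfun.add_right blinfun.scaleR_right h ak)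
    ultimately show False using dual_bound[of "(1 / 2) *\<^sub>R h + (1 / 2) *\<^sub>R k"] by linarith
  qed
  have opt_iff: "optimal_descent_direction f A h \<longleftrightarrow> blinfun_apply a h = - d \<and> norm h = 1" for h
  proof
    assume "optimal_descent_direction f A h"
    then have h: "norm h = 1" "P h = - d" by (auto simp: opt)
    have "blinfun_apply a h \<le> P h" using a(1) G by blast
    with dual_bound[of h] h show "blinfun_apply a h = - d \<and> norm h = 1" by simp
  next
    assume "blinfun_apply a h = - d \<and> norm h = 1"
    \<comment> \<open>The value of \<open>a\<close> at \<open>h\<close> bounds \<open>P h\<close>
      only from below, so this direction goes through uniqueness: \<open>h\<close> must be the known
      optimal \<open>k\<close>.\<close>
    then have "h = k" using unique by blast
    then show "optimal_descent_direction f A h" using k opt by simp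
  qed
  have opt_k: "optimal_descent_direction f A h \<longleftrightarrow> h = k" for h
    using opt_iff opt unique k by blast
  have "descent_direction f A h" if h: "norm (h - k) < d / L" for h
  proof -
    \<comment> \<open>Division by zero yields 0, so for \<open>L = 0\<close> the hypothesis would
      demand a negative norm.\<close>
    have "L \<noteq> 0" using h by auto
    then have "L * norm (h - k) < d" using h L0 by (simp add: field_simps)
    moreover have "P h \<le> P k + P (h - k)" using sublinear_add[OF P(1), of k "h - k"] by simp
    ultimately have "P h < 0" using P(3)[of "h - k"] k by linarith
    then show ?thesis by (simp add: descent_direction_def P(2))
  qed
  moreover have "h = k \<longleftrightarrow> blinfun_apply a h = - norm a \<and> norm h = 1" for h
    using opt_iff[of h] opt_k[of h] a(2) by simp
  ultimately show ?thesis
    unfolding G_def[symmetric] arg_min opt_k a(2)[symmetric] by blast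
qed

end
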